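(* Consider the integer points $1, \ldots, n$ of the real line, and let each point independently host a node with probability $p$. Let each existing node be connected to its nearest existing neighbor on each side and to $1$ long-distance neighbor chosen among the existing nodes with probability inversely proportional to its distance (i.e., existing node $u$ picks existing $v \neq u$ with probability $\frac{1/d(u,v)}{\sum_{v'} 1/d(u,v')}$, the sum over existing $v' \ne u$, where $d(u,v)=|u-v|$). Messages are routed greedily, each node forwarding the message to its neighbor closest to the target. Then the worst-case expected delivery time is $O(\log^2 n)$.
   Context: The delivery time is the number of hops taken to route a message from a source node to a target node. *)

theory Defs
  imports "HOL-Probability.Probability" "HOL-Library.Landau_Symbols"
begin

definition pdist :: "nat \<Rightarrow> nat \<Rightarrow> real" where
  "pdist u v = \<bar>real u - real v\<bar>"

definition nodes_pmf :: "nat \<Rightarrow> real \<Rightarrow> nat set pmf" where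
  "nodes_pmf n p =
     map_pmf (\<lambda>X. {i \<in> {1..n}. X i}) (Pi_pmf {1..n} False (\<lambda>_. bernoulli_pmf p))"

(* A node with no other node around has nobody to link to; it gets the dummy link to itself. *)
definition link_pmf :: "nat set \<Rightarrow> nat \<Rightarrow> nat pmf" where
  "link_pmf S u =
     (if S - {u} = {} then return_pmf u
      else embed_pmf (\<lambda>v. if v \<in> S - {u}
                          then (1 / pdist u v) / (\<Sum>v'\<in>S - {u}. 1 / pdist u v') else 0))"

lemma pmf_link_pmf:
  assumes "finite S" and "S - {u} \<noteq> {}"
  shows "pmf (link_pmf S u) v =
    (if v \<in> S - {u} then (1 / pdist u v) / (\<Sum>v'\<in>S - {u}. 1 / pdist u v') else 0)"
proof -
  define Z where "Z = (\<Sum>v'\<in>S - {u}. 1 / pdist u v')"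
  have Z: "Z > 0"
    unfolding Z_def using assms by (intro sum_pos) (auto simp: pdist_def)
  let ?f = "\<lambda>v. if v \<in> S - {u} then (1 / pdist u v) / Z else 0"
  have nn: "0 \<le> ?f v" for v
    using Z by (auto simp: pdist_def)
  have "(\<integral>\<^sup>+v. ennreal (?f v) \<partial>count_space UNIV) = (\<Sum>v\<in>S - {u}. ennreal (?f v))"
    using assms(1) by (intro nn_integral_count_space') auto
  also have "\<dots> = ennreal (\<Sum>v\<in>S - {u}. ?f v)"
    by (intro sum_ennreal nn)
  also have "(\<Sum>v\<in>S - {u}. ?f v) = (\<Sum>v\<in>S - {u}. 1 / pdist u v) / Z"
    by (simp add: sum_divide_distrib)
  also have "\<dots> = 1"
    using Z by (simp add: Z_def)
  finally have "pmf (embed_pmf ?f) v = ?f v"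
    by (intro pmf_embed_pmf nn) simp
  moreover have "link_pmf S u = embed_pmf ?f"
    using assms(2) unfolding link_pmf_def Z_def by (simp only: if_False)
  ultimately show ?thesis
    by (simp add: Z_def)
qed

definition network_pmf :: "nat \<Rightarrow> real \<Rightarrow> (nat set \<times> (nat \<Rightarrow> nat)) pmf" where
  "network_pmf n p =
     bind_pmf (nodes_pmf n p) (\<lambda>S. map_pmf (\<lambda>L. (S, L)) (Pi_pmf S 0 (link_pmf S)))"

definition nearest_left :: "nat set \<Rightarrow> nat \<Rightarrow> nat set" where
  "nearest_left S u = {v \<in> S. v < u \<and> (\<forall>w\<in>S. w < u \<longrightarrow> w \<le> v)}"

definition nearest_right :: "nat set \<Rightarrow> nat \<Rightarrow> nat set" where
  "nearest_right S u = {v \<in> S. u < v \<and> (\<forall>w\<in>S. u < w \<longrightarrow> v \<le> w)}"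

definition neighbors :: "nat set \<Rightarrow> (nat \<Rightarrow> nat) \<Rightarrow> nat \<Rightarrow> nat set" where
  "neighbors S L u = nearest_left S u \<union> nearest_right S u \<union> {L u}"

(* g u t A: the element of A to which u forwards a message for t. Two neighbors on opposite
   sides of t can be equally close to it; g decides such ties, in any way whatsoever. *)
definition greedy_rule :: "(nat \<Rightarrow> nat \<Rightarrow> nat set \<Rightarrow> nat) \<Rightarrow> bool" where
  "greedy_rule g \<longleftrightarrow>
     (\<forall>u t A. finite A \<longrightarrow> A \<noteq> {} \<longrightarrow> is_arg_min (\<lambda>v. pdist v t) (\<lambda>v. v \<in> A) (g u t A))"

definition route ::
  "(nat \<Rightarrow> nat \<Rightarrow> nat set \<Rightarrow> nat) \<Rightarrow> nat set \<Rightarrow> (nat \<Rightarrow> nat) \<Rightarrow> nat \<Rightarrow> nat \<Rightarrow> nat \<Rightarrow> nat" where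
  "route g S L s t k = ((\<lambda>u. g u t (neighbors S L u)) ^^ k) s"

definition delivery_time ::
  "(nat \<Rightarrow> nat \<Rightarrow> nat set \<Rightarrow> nat) \<Rightarrow> nat set \<Rightarrow> (nat \<Rightarrow> nat) \<Rightarrow> nat \<Rightarrow> nat \<Rightarrow> nat" where
  "delivery_time g S L s t = (LEAST k. route g S L s t k = t)"

lemma finite_neighbors: "finite S \<Longrightarrow> finite (neighbors S L u)"
  by (auto simp: neighbors_def nearest_left_def nearest_right_def)

lemma greedy_step:
  assumes g: "greedy_rule g" and S: "finite S" "t \<in> S" "u \<in> S" "u \<noteq> t" "L u \<in> S"
  shows "g u t (neighbors S L u) \<in> S" and "pdist (g u t (neighbors S L u)) t < pdist u t"
proof -
  have "\<exists>v \<in> neighbors S L u. pdist v t < pdist u t"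
  proof (cases "u < t")
    case True
    define v where "v = Min {w \<in> S. u < w}"
    have ne: "finite {w \<in> S. u < w}" "{w \<in> S. u < w} \<noteq> {}"
      using S True by auto
    have "v \<in> {w \<in> S. u < w}" "\<And>w. w \<in> S \<Longrightarrow> u < w \<Longrightarrow> v \<le> w"
      unfolding v_def using ne Min_in[OF ne] by auto
    then have "v \<in> neighbors S L u" "u < v" "v \<le> t"
      using S True by (auto simp: neighbors_def nearest_right_def)
    then show ?thesis
      by (intro bexI[of _ v]) (auto simp: pdist_def)
  next
    case False
    define v where "v = Max {w \<in> S. w < u}"
    have ne: "finite {w \<in> S. w < u}" "{w \<in> S. w < u} \<noteq> {}"
      using S False by auto
    have "v \<in> {w \<in> S. w < u}" "\<And>w. w \<in> S \<Longrightarrow> w < u \<Longrightarrow> w \<le> v"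
      unfolding v_def using ne Max_in[OF ne] by auto
    then have "v \<in> neighbors S L u" "v < u" "t \<le> v"
      using S False by (auto simp: neighbors_def nearest_left_def)
    then show ?thesis
      by (intro bexI[of _ v]) (auto simp: pdist_def)
  qed
  then obtain v where v: "v \<in> neighbors S L u" "pdist v t < pdist u t" by blast
  have *: "is_arg_min (\<lambda>v. pdist v t) (\<lambda>v. v \<in> neighbors S L u) (g u t (neighbors S L u))"
    using g finite_neighbors[OF S(1)] v(1) unfolding greedy_rule_def by blast
  then show "pdist (g u t (neighbors S L u)) t < pdist u t"
    using v by (auto simp: is_arg_min_linorder intro: le_less_trans)
  show "g u t (neighbors S L u) \<in> S"
    using * S by (auto simp: is_arg_min_def neighbors_def nearest_left_def nearest_right_def)
qed

(* Every message is delivered, so the LEAST in delivery_time is always attained. *)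
lemma route_reaches_target:
  assumes g: "greedy_rule g" and S: "finite S" "t \<in> S" "s \<in> S" "\<And>u. u \<in> S \<Longrightarrow> L u \<in> S"
  shows "\<exists>k. route g S L s t k = t"
  using S(3)
proof (induction "nat \<lfloor>pdist s t\<rfloor>" arbitrary: s rule: less_induct)
  case less
  show ?case
  proof (cases "s = t")
    case True
    then have "route g S L s t 0 = t" by (simp add: route_def)
    then show ?thesis ..
  next
    case False
    let ?v = "g s t (neighbors S L s)"
    have v: "?v \<in> S" "pdist ?v t < pdist s t"
      using greedy_step[where L = L, OF g S(1,2) less.prems False S(4)[OF less.prems]] by auto
    have fl: "pdist x t = of_int \<bar>int x - int t\<bar>" for x
      by (simp add: pdist_def)
    have "nat \<lfloor>pdist ?v t\<rfloor> < nat \<lfloor>pdist s t\<rfloor>"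
      using v(2) unfolding fl floor_of_int of_int_less_iff by linarith
    then obtain k where "route g S L ?v t k = t"
      using less.hyps v(1) by blast
    then have "route g S L s t (Suc k) = t"
      by (simp add: route_def funpow_Suc_right del: funpow.simps)
    then show ?thesis ..
  qed
qed

definition expected_delivery_time ::
  "(nat \<Rightarrow> nat \<Rightarrow> nat set \<Rightarrow> nat) \<Rightarrow> nat \<Rightarrow> real \<Rightarrow> nat \<Rightarrow> nat \<Rightarrow> real" where
  "expected_delivery_time g n p s t =
     measure_pmf.expectation (cond_pmf (network_pmf n p) {(S, L). s \<in> S \<and> t \<in> S})
       (\<lambda>(S, L). real (delivery_time g S L s t))"

(* cond_pmf is meaningful only if the conditioning event has positive probability. *)
lemma network_pmf_cond_nonempty:
  assumes "0 < p" "p \<le> 1" "s \<in> {1..n}" "t \<in> {1..n}"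
  shows "set_pmf (network_pmf n p) \<inter> {(S, L). s \<in> S \<and> t \<in> S} \<noteq> {}"
proof -
  have "(\<lambda>i. i \<in> {1..n}) \<in> set_pmf (Pi_pmf {1..n} False (\<lambda>_. bernoulli_pmf p))"
    using assms by (auto simp: set_Pi_pmf set_pmf_bernoulli PiE_dflt_def set_pmf_iff)
  then have "{1..n} \<in> set_pmf (nodes_pmf n p)"
    unfolding nodes_pmf_def set_map_pmf by (rule rev_image_eqI) auto
  moreover obtain L where "L \<in> set_pmf (Pi_pmf {1..n} 0 (link_pmf {1..n}))"
    using set_pmf_not_empty[of "Pi_pmf {1..n} 0 (link_pmf {1..n})"] by blast
  ultimately have "({1..n}, L) \<in> set_pmf (network_pmf n p)"
    by (auto simp: network_pmf_def)
  then show ?thesis using assms by blast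
qed

definition worst_case_expected_delivery_time ::
  "(nat \<Rightarrow> nat \<Rightarrow> nat set \<Rightarrow> nat) \<Rightarrow> real \<Rightarrow> nat \<Rightarrow> real" where
  "worst_case_expected_delivery_time g p n =
     Max {expected_delivery_time g n p s t | s t. s \<in> {1..n} \<and> t \<in> {1..n}}"

end

theory Submission
  imports Defs "HOL-Analysis.Harmonic_Numbers"
begin

text \<open>Fix the set \<open>S\<close> of nodes and the target \<open>t\<close>, and let $N_k$ be the number of nodes within
  distance $2^k$ of \<open>t\<close>. At a distance in $(2^k, 2^{k+1}]$ from \<open>t\<close> the long-distance link
  leads into that ball with probability at least $N_k / (3 \cdot 2^k \cdot 2 H_n)$, and the links
  of successive nodes on the route are independent of each other because the distance to \<open>t\<close>
  decreases strictly. So the expected time spent at this scale is at most $6 H_n 2^k / N_k$.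
  Given that \<open>s\<close> and \<open>t\<close> host nodes, $N_k$ dominates \<open>1 + X\<close> with \<open>X\<close> binomial on the $2^k$ points
  next to \<open>t\<close> on the side of \<open>s\<close>, and $E[1/(1+X)] \le 1/((2^k+1)p)$. Hence each of the
  $O(\log n)$ scales contributes $O(H_n/p)$, and no concentration inequality is needed.\<close>

section \<open>Finitely supported probability mass functions\<close>

lemma expectation_bind_pmf_finite:
  fixes h :: "'b \<Rightarrow> real"
  assumes "finite (set_pmf p)" and "\<And>x. x \<in> set_pmf p \<Longrightarrow> finite (set_pmf (f x))"
  shows "measure_pmf.expectation (p \<bind> f) h =
    measure_pmf.expectation p (\<lambda>x. measure_pmf.expectation (f x) h)"
  using assms
  by (simp add: pmf_expectation_bind[of "set_pmf p"] integral_measure_pmf[of "set_pmf p"])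

lemma expectation_mono_pmf_finite:
  fixes f h :: "'a \<Rightarrow> real"
  assumes "finite (set_pmf p)" and "\<And>x. x \<in> set_pmf p \<Longrightarrow> f x \<le> h x"
  shows "measure_pmf.expectation p f \<le> measure_pmf.expectation p h"
  using assms by (intro integral_mono_AE integrable_measure_pmf_finite) (auto simp: AE_measure_pmf_iff)

lemma expectation_cong_pmf:
  fixes f h :: "'a \<Rightarrow> real"
  assumes "\<And>x. x \<in> set_pmf p \<Longrightarrow> f x = h x"
  shows "measure_pmf.expectation p f = measure_pmf.expectation p h"
  using assms by (intro integral_cong_AE) (auto simp: AE_measure_pmf_iff)

lemma expectation_cond_pmf_finite:
  fixes f :: "'a \<Rightarrow> real"
  assumes fin: "finite (set_pmf p)" and ne: "set_pmf p \<inter> A \<noteq> {}"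
  shows "measure_pmf.expectation (cond_pmf p A) f =
    measure_pmf.expectation p (\<lambda>x. indicator A x * f x) / measure_pmf.prob p A"
proof -
  have "measure_pmf.expectation (cond_pmf p A) f =
      (\<Sum>a\<in>set_pmf p. f a * pmf (cond_pmf p A) a)"
    using fin ne by (intro integral_measure_pmf_real) auto
  also have "\<dots> = (\<Sum>a\<in>set_pmf p. (indicator A a * f a) * pmf p a / measure_pmf.prob p A)"
    by (intro sum.cong) (auto simp: pmf_cond[OF ne])
  also have "\<dots> = (\<Sum>a\<in>set_pmf p. (indicator A a * f a) * pmf p a) / measure_pmf.prob p A"
    by (simp add: sum_divide_distrib)
  also have "(\<Sum>a\<in>set_pmf p. (indicator A a * f a) * pmf p a) =
      measure_pmf.expectation p (\<lambda>x. indicator A x * f x)"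
    using fin by (intro integral_measure_pmf_real[symmetric]) auto
  finally show ?thesis .
qed

lemma finite_set_Pi_pmf:
  assumes "finite A" and "\<And>x. x \<in> A \<Longrightarrow> finite (set_pmf (p x))"
  shows "finite (set_pmf (Pi_pmf A d p))"
  using assms by (simp add: set_Pi_pmf finite_PiE_dflt)

lemma expectation_Pi_pmf_disjoint:
  fixes f h :: "('a \<Rightarrow> 'b) \<Rightarrow> real"
  assumes fin: "finite D" "\<And>x. x \<in> D \<Longrightarrow> finite (set_pmf (p x))"
    and B: "B \<subseteq> D"
    and f: "\<And>X Y. (\<And>x. x \<in> B \<Longrightarrow> X x = Y x) \<Longrightarrow> f X = f Y"
    and h: "\<And>X Y. (\<And>x. x \<notin> B \<Longrightarrow> X x = Y x) \<Longrightarrow> h X = h Y"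
  shows "measure_pmf.expectation (Pi_pmf D d p) (\<lambda>X. f X * h X) =
    measure_pmf.expectation (Pi_pmf D d p) f * measure_pmf.expectation (Pi_pmf D d p) h"
proof -
  let ?P = "Pi_pmf B d p" and ?Q = "Pi_pmf (D - B) d p"
  let ?m = "\<lambda>X Y x. if x \<in> B then X x else Y x"
  have finP: "finite (set_pmf ?P)" and finQ: "finite (set_pmf ?Q)"
    using fin B by (auto intro!: finite_set_Pi_pmf intro: finite_subset)
  have split: "Pi_pmf D d p = ?P \<bind> (\<lambda>X. map_pmf (?m X) ?Q)"
  proof -
    have "Pi_pmf D d p = Pi_pmf (B \<union> (D - B)) d p"
      using B by (simp add: Un_absorb1)
    also have "\<dots> = map_pmf (\<lambda>(X, Y). ?m X Y) (pair_pmf ?P ?Q)"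
      using fin(1) B by (intro Pi_pmf_union) (auto intro: finite_subset)
    also have "\<dots> = ?P \<bind> (\<lambda>X. map_pmf (?m X) ?Q)"
      by (simp add: pair_pmf_def map_pmf_def bind_assoc_pmf bind_return_pmf)
    finally show ?thesis .
  qed
  have E: "measure_pmf.expectation (Pi_pmf D d p) F =
      measure_pmf.expectation ?P (\<lambda>X. measure_pmf.expectation ?Q (\<lambda>Y. F (?m X Y)))"
    for F :: "_ \<Rightarrow> real"
    unfolding split using finP finQ by (subst expectation_bind_pmf_finite) simp_all
  have f': "f (?m X Y) = f X" for X Y
    by (rule f) simp
  have h': "h (?m X Y) = h Y" for X Y
    by (rule h) simp
  have "measure_pmf.expectation (Pi_pmf D d p) (\<lambda>X. f X * h X) =
      measure_pmf.expectation ?P (\<lambda>X. f X * measure_pmf.expectation ?Q h)"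
    unfolding E by (intro expectation_cong_pmf) (simp add: f' h')
  also have "\<dots> = measure_pmf.expectation ?P f * measure_pmf.expectation ?Q h"
    by simp
  also have "measure_pmf.expectation ?P f = measure_pmf.expectation (Pi_pmf D d p) f"
    unfolding E by (simp add: f')
  also have "measure_pmf.expectation ?Q h = measure_pmf.expectation (Pi_pmf D d p) h"
    unfolding E using expectation_cong_pmf[of ?P "\<lambda>X. measure_pmf.expectation ?Q (\<lambda>Y. h (?m X Y))"
      "\<lambda>X. measure_pmf.expectation ?Q h"] by (simp add: h')
  finally show ?thesis .
qed

text \<open>The weights $\binom{m}{k} p^{k+1} q^{m-k} / (k+1)$ are $1/(m+1)$ times the weights of
  \<open>k + 1\<close> successes in \<open>m + 1\<close> trials.\<close>

lemma expectation_inverse_Suc_binomial: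
  fixes p :: real
  assumes p: "0 < p" "p \<le> 1"
  shows "measure_pmf.expectation (binomial_pmf m p) (\<lambda>k. 1 / (real k + 1)) \<le> 1 / ((real m + 1) * p)"
proof -
  let ?b = "\<lambda>k. real (Suc m choose k) * p ^ k * (1 - p) ^ (Suc m - k)"
  have "measure_pmf.expectation (binomial_pmf m p) (\<lambda>k. 1 / (real k + 1)) =
      (\<Sum>k\<le>m. real (m choose k) * p ^ k * (1 - p) ^ (m - k) * (1 / (real k + 1)))"
    using p by (subst expectation_binomial_pmf') auto
  also have "\<dots> = (\<Sum>k\<le>m. ?b (Suc k) / ((real m + 1) * p))"
  proof (intro sum.cong refl)
    fix k
    have "(real k + 1) * real (Suc m choose Suc k) = (real m + 1) * real (m choose k)"
      using arg_cong[OF Suc_times_binomial_eq[of m k], of real]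
      by (simp add: algebra_simps del: binomial_Suc_Suc)
    then have *: "real (Suc m choose Suc k) = (real m + 1) * real (m choose k) / (real k + 1)"
      by (simp add: eq_divide_eq mult.commute del: binomial_Suc_Suc)
    have "real m + 1 \<noteq> 0" by linarith
    with p show "real (m choose k) * p ^ k * (1 - p) ^ (m - k) * (1 / (real k + 1)) =
        ?b (Suc k) / ((real m + 1) * p)"
      unfolding * by simp
  qed
  also have "\<dots> = (\<Sum>k\<le>m. ?b (Suc k)) / ((real m + 1) * p)"
    by (simp add: sum_divide_distrib)
  also have "\<dots> \<le> 1 / ((real m + 1) * p)"
  proof (intro divide_right_mono)
    have "(\<Sum>k\<le>m. ?b (Suc k)) \<le> ?b 0 + (\<Sum>k\<le>m. ?b (Suc k))"
      using p by simp
    also have "\<dots> = (\<Sum>k\<le>Suc m. ?b k)"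
      by (simp only: sum.atMost_Suc_shift)
    also have "\<dots> = (p + (1 - p)) ^ Suc m"
      by (simp only: binomial_ring)
    finally show "(\<Sum>k\<le>m. ?b (Suc k)) \<le> 1" by simp
  qed (use p in auto)
  finally show ?thesis .
qed

section \<open>The distribution of the hosts\<close>

lemma finite_set_nodes_pmf: "finite (set_pmf (nodes_pmf n p))"
  unfolding nodes_pmf_def by (auto intro!: finite_set_Pi_pmf)

lemma set_nodes_pmf_subset: "S \<in> set_pmf (nodes_pmf n p) \<Longrightarrow> S \<subseteq> {1..n}"
  by (auto simp: nodes_pmf_def)

lemma expectation_inverse_card_nodes:
  fixes p :: real
  assumes p: "0 < p" "p \<le> 1" and A: "A \<subseteq> {1..n}" and B: "B \<subseteq> {1..n}" and AB: "A \<inter> B = {}"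
  shows "measure_pmf.expectation (nodes_pmf n p) (\<lambda>S. of_bool (B \<subseteq> S) * (1 / (1 + real (card (S \<inter> A)))))
    \<le> measure_pmf.prob (nodes_pmf n p) {S. B \<subseteq> S} / ((real (card A) + 1) * p)"
proof -
  let ?D = "{1..n}"
  let ?P = "Pi_pmf ?D False (\<lambda>_. bernoulli_pmf p)"
  let ?nodes = "\<lambda>X. {i \<in> ?D. X i}"
  have finA: "finite A"
    using A by (rule finite_subset) simp
  have "measure_pmf.expectation (nodes_pmf n p) (\<lambda>S. of_bool (B \<subseteq> S) * (1 / (1 + real (card (S \<inter> A))))) =
      measure_pmf.expectation ?P (\<lambda>X. of_bool (B \<subseteq> ?nodes X) * (1 / (1 + real (card (?nodes X \<inter> A)))))"
    by (simp add: nodes_pmf_def)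
  also have "\<dots> = measure_pmf.expectation ?P (\<lambda>X. of_bool (B \<subseteq> ?nodes X)) *
      measure_pmf.expectation ?P (\<lambda>X. 1 / (1 + real (card (?nodes X \<inter> A))))"
  proof (rule expectation_Pi_pmf_disjoint[where B = B])
    fix X Y :: "nat \<Rightarrow> bool" assume "\<And>x. x \<in> B \<Longrightarrow> X x = Y x"
    then show "(of_bool (B \<subseteq> ?nodes X) :: real) = of_bool (B \<subseteq> ?nodes Y)"
      by (intro arg_cong[of _ _ of_bool]) auto
  next
    fix X Y :: "nat \<Rightarrow> bool" assume "\<And>x. x \<notin> B \<Longrightarrow> X x = Y x"
    then have "?nodes X \<inter> A = ?nodes Y \<inter> A"
      using AB by auto
    then show "1 / (1 + real (card (?nodes X \<inter> A))) = 1 / (1 + real (card (?nodes Y \<inter> A)))"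
      by simp
  qed (use B in auto)
  also have "measure_pmf.expectation ?P (\<lambda>X. of_bool (B \<subseteq> ?nodes X) :: real) =
      measure_pmf.expectation (nodes_pmf n p) (\<lambda>S. indicator {S. B \<subseteq> S} S :: real)"
    by (simp only: nodes_pmf_def integral_map_pmf indicator_def mem_Collect_eq)
  also have "\<dots> = measure_pmf.prob (nodes_pmf n p) {S. B \<subseteq> S}"
    by simp
  also have "measure_pmf.expectation ?P (\<lambda>X. 1 / (1 + real (card (?nodes X \<inter> A)))) \<le>
      1 / ((real (card A) + 1) * p)"
  proof -
    let ?r = "\<lambda>X x. if x \<in> A then X x else False"
    have "binomial_pmf (card A) p =
        map_pmf (\<lambda>X. card {x \<in> A. X x}) (Pi_pmf A False (\<lambda>_. bernoulli_pmf p))"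
      using finA p by (intro binomial_pmf_altdef') auto
    also have "Pi_pmf A False (\<lambda>_. bernoulli_pmf p) = map_pmf ?r ?P"
      using A by (intro Pi_pmf_subset) auto
    finally have *: "binomial_pmf (card A) p = map_pmf (\<lambda>X. card {x \<in> A. ?r X x}) ?P"
      by (simp add: map_pmf_comp)
    have **: "{x \<in> A. ?r X x} = ?nodes X \<inter> A" for X
      using A by auto
    show ?thesis
      using expectation_inverse_Suc_binomial[OF p, of "card A"] unfolding * ** by (simp add: add.commute)
  qed
  finally show ?thesis
    by (simp add: mult_left_mono)
qed

section \<open>Greedy routing on a fixed set of nodes\<close>

lemma set_link_pmf:
  assumes "finite S" and "u \<in> S"
  shows "set_pmf (link_pmf S u) \<subseteq> S"
proof (cases "S - {u} = {}")
  case True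
  then show ?thesis
    using assms by (simp add: link_pmf_def)
next
  case False
  then show ?thesis
    by (auto simp: set_pmf_iff pmf_link_pmf[OF assms(1) False] split: if_splits)
qed

lemma finite_set_links_pmf:
  assumes "finite S"
  shows "finite (set_pmf (Pi_pmf S 0 (link_pmf S)))"
  using assms by (auto intro!: finite_set_Pi_pmf intro: finite_subset[OF set_link_pmf])

lemma set_links_pmf:
  assumes "finite S" and "L \<in> set_pmf (Pi_pmf A 0 (link_pmf S))" and "A \<subseteq> S" and "u \<in> A"
  shows "L u \<in> S"
proof -
  have "finite A"
    using assms(1,3) by (rule rev_finite_subset)
  then have "L u \<in> set_pmf (link_pmf S u)"
    using assms(2,4) by (auto simp: set_Pi_pmf PiE_dflt_def)
  then show ?thesis
    using set_link_pmf[of S u] assms by auto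
qed

lemma nat_floor_pdist_less:
  assumes "pdist v t < pdist u t"
  shows "nat \<lfloor>pdist v t\<rfloor> < nat \<lfloor>pdist u t\<rfloor>"
proof -
  have "pdist x t = of_int \<bar>int x - int t\<bar>" for x
    by (simp add: pdist_def)
  then show ?thesis
    using assms by (simp only: floor_of_int of_int_less_iff)
qed

lemma delivery_time_self: "delivery_time g S L t t = 0"
  by (simp add: delivery_time_def route_def)

lemma delivery_time_step:
  assumes "greedy_rule g" "finite S" "t \<in> S" "u \<in> S" "u \<noteq> t" "\<And>v. v \<in> S \<Longrightarrow> L v \<in> S"
  shows "delivery_time g S L u t = Suc (delivery_time g S L (g u t (neighbors S L u)) t)"
proof -
  obtain k where k: "route g S L u t k = t"
    using route_reaches_target[where L = L, OF assms(1-4,6)] by blast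
  have shift: "route g S L u t (Suc k) = route g S L (g u t (neighbors S L u)) t k" for k
    by (simp add: route_def funpow_Suc_right del: funpow.simps)
  have "(LEAST k. route g S L u t k = t) = Suc (LEAST k. route g S L u t (Suc k) = t)"
    using k assms(5) by (intro Least_Suc) (simp_all add: route_def)
  then show ?thesis
    by (simp only: delivery_time_def shift)
qed

lemma delivery_time_cong:
  assumes g: "greedy_rule g" and S: "finite S" "t \<in> S" "v \<in> S"
    and L: "\<And>w. w \<in> S \<Longrightarrow> L w \<in> S" and L': "\<And>w. w \<in> S \<Longrightarrow> L' w \<in> S"
    and eq: "\<And>w. w \<in> S \<Longrightarrow> pdist w t \<le> pdist v t \<Longrightarrow> L w = L' w"
  shows "delivery_time g S L v t = delivery_time g S L' v t"
  using S(3) eq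
proof (induction "nat \<lfloor>pdist v t\<rfloor>" arbitrary: v rule: less_induct)
  case less
  show ?case
  proof (cases "v = t")
    case False
    let ?w = "g v t (neighbors S L v)"
    have w: "?w \<in> S" "pdist ?w t < pdist v t"
      using greedy_step[where L = L, OF g S(1,2) less.prems(1) False L[OF less.prems(1)]] by auto
    have "neighbors S L' v = neighbors S L v"
      using less.prems by (simp add: neighbors_def)
    moreover have "delivery_time g S L ?w t = delivery_time g S L' ?w t"
      using less.hyps[OF nat_floor_pdist_less[OF w(2)] w(1)] less.prems(2) w(2) by simp
    ultimately show ?thesis
      using delivery_time_step[where L = L, OF g S(1,2) less.prems(1) False L]
        delivery_time_step[where L = L', OF g S(1,2) less.prems(1) False L'] by simp
  qed (simp add: delivery_time_self)
qed

definition fixed_nodes_time ::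
  "(nat \<Rightarrow> nat \<Rightarrow> nat set \<Rightarrow> nat) \<Rightarrow> nat set \<Rightarrow> nat \<Rightarrow> nat \<Rightarrow> real" where
  "fixed_nodes_time g S u t =
     measure_pmf.expectation (Pi_pmf S 0 (link_pmf S)) (\<lambda>L. real (delivery_time g S L u t))"

definition next_hop :: "(nat \<Rightarrow> nat \<Rightarrow> nat set \<Rightarrow> nat) \<Rightarrow> nat set \<Rightarrow> nat \<Rightarrow> nat \<Rightarrow> nat \<Rightarrow> nat" where
  "next_hop g S u t x = g u t (nearest_left S u \<union> nearest_right S u \<union> {x})"

lemma next_hop_neighbors: "g u t (neighbors S L u) = next_hop g S u t (L u)"
  by (simp add: next_hop_def neighbors_def)

lemma next_hop_closer:
  assumes "greedy_rule g" "finite S" "t \<in> S" "u \<in> S" "u \<noteq> t" "x \<in> S"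
  shows "next_hop g S u t x \<in> S" and "pdist (next_hop g S u t x) t < pdist u t"
  using greedy_step[where L = "\<lambda>_. x", OF assms] by (simp_all add: next_hop_neighbors)

lemma next_hop_le_link:
  assumes "greedy_rule g" "finite S"
  shows "pdist (next_hop g S u t x) t \<le> pdist x t"
  using assms finite_neighbors[of S "\<lambda>_. x" u]
  by (auto simp: greedy_rule_def is_arg_min_linorder next_hop_def neighbors_def)

text \<open>The nodes visited after \<open>u\<close> are strictly closer to the target, so the rest of the route
  does not depend on the link of \<open>u\<close>.\<close>

lemma fixed_nodes_time_step:
  assumes g: "greedy_rule g" and S: "finite S" "t \<in> S" "u \<in> S" "u \<noteq> t"
  shows "fixed_nodes_time g S u t =
    1 + measure_pmf.expectation (link_pmf S u) (\<lambda>x. fixed_nodes_time g S (next_hop g S u t x) t)"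
proof -
  let ?P = "Pi_pmf S 0 (link_pmf S)" and ?Q = "Pi_pmf (S - {u}) 0 (link_pmf S)"
  let ?T = "\<lambda>L v. real (delivery_time g S L v t)"
  have split: "?P = link_pmf S u \<bind> (\<lambda>x. map_pmf (\<lambda>L. L(u := x)) ?Q)"
  proof -
    have "?P = Pi_pmf (insert u (S - {u})) 0 (link_pmf S)"
      using S by (simp add: insert_absorb)
    also have "\<dots> = link_pmf S u \<bind> (\<lambda>x. map_pmf (\<lambda>L. L(u := x)) ?Q)"
      using S by (subst Pi_pmf_insert') (auto simp: map_pmf_def)
    finally show ?thesis .
  qed
  have finu: "finite (set_pmf (link_pmf S u))"
    using set_link_pmf[OF S(1,3)] S(1) by (rule finite_subset)
  have finQ: "finite (set_pmf ?Q)"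
    using S(1) by (auto intro!: finite_set_Pi_pmf intro: finite_subset[OF set_link_pmf])
  have E: "measure_pmf.expectation ?P F = measure_pmf.expectation (link_pmf S u)
      (\<lambda>x. measure_pmf.expectation ?Q (\<lambda>L. F (L(u := x))))" for F :: "_ \<Rightarrow> real"
    unfolding split using finu finQ by (subst expectation_bind_pmf_finite) simp_all
  have upd: "(L(u := x)) w \<in> S" if "L \<in> set_pmf ?Q" "x \<in> S" "w \<in> S" for L x w
    using set_links_pmf[OF S(1) that(1), of w] that by auto
  have indep: "measure_pmf.expectation ?Q (\<lambda>L. ?T (L(u := x)) v) = fixed_nodes_time g S v t"
    if x: "x \<in> S" and v: "v \<in> S" "pdist v t < pdist u t" for x v
  proof -
    have "measure_pmf.expectation ?Q (\<lambda>L. ?T (L(u := y)) v) =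
        measure_pmf.expectation ?Q (\<lambda>L. ?T (L(u := x)) v)" if y: "y \<in> set_pmf (link_pmf S u)" for y
    proof (intro expectation_cong_pmf arg_cong[of _ _ real])
      fix L assume L: "L \<in> set_pmf ?Q"
      have "y \<in> S"
        using y set_link_pmf[OF S(1,3)] by auto
      then show "delivery_time g S (L(u := y)) v t = delivery_time g S (L(u := x)) v t"
        using v(2) by (intro delivery_time_cong g S v upd L x) auto
    qed
    then have "fixed_nodes_time g S v t = measure_pmf.expectation (link_pmf S u)
        (\<lambda>_. measure_pmf.expectation ?Q (\<lambda>L. ?T (L(u := x)) v))"
      unfolding fixed_nodes_time_def E by (rule expectation_cong_pmf)
    then show ?thesis by simp
  qed
  have "fixed_nodes_time g S u t = measure_pmf.expectation (link_pmf S u)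
      (\<lambda>x. 1 + fixed_nodes_time g S (next_hop g S u t x) t)"
    unfolding fixed_nodes_time_def[of g S u] E
  proof (intro expectation_cong_pmf)
    fix x assume "x \<in> set_pmf (link_pmf S u)"
    then have x: "x \<in> S"
      using set_link_pmf[OF S(1,3)] by auto
    have "measure_pmf.expectation ?Q (\<lambda>L. ?T (L(u := x)) u) =
        measure_pmf.expectation ?Q (\<lambda>L. 1 + ?T (L(u := x)) (next_hop g S u t x))"
    proof (intro expectation_cong_pmf)
      fix L assume L: "L \<in> set_pmf ?Q"
      show "?T (L(u := x)) u = 1 + ?T (L(u := x)) (next_hop g S u t x)"
        using delivery_time_step[where L = "L(u := x)", OF g S upd[OF L x]]
        by (simp add: next_hop_neighbors)
    qed
    also have "\<dots> = 1 + measure_pmf.expectation ?Q (\<lambda>L. ?T (L(u := x)) (next_hop g S u t x))"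
      using finQ by (subst Bochner_Integration.integral_add) (auto intro: integrable_measure_pmf_finite)
    also have "measure_pmf.expectation ?Q (\<lambda>L. ?T (L(u := x)) (next_hop g S u t x)) =
        fixed_nodes_time g S (next_hop g S u t x) t"
      by (intro indep next_hop_closer g S x)
    finally show "measure_pmf.expectation ?Q (\<lambda>L. ?T (L(u := x)) u) =
        1 + fixed_nodes_time g S (next_hop g S u t x) t" .
  qed
  also have "\<dots> = 1 + measure_pmf.expectation (link_pmf S u)
      (\<lambda>x. fixed_nodes_time g S (next_hop g S u t x) t)"
    using finu by (subst Bochner_Integration.integral_add) (auto intro: integrable_measure_pmf_finite)
  finally show ?thesis .
qed

definition near_nodes :: "nat set \<Rightarrow> nat \<Rightarrow> nat \<Rightarrow> nat set" where
  "near_nodes S t k = {v \<in> S. pdist v t \<le> 2 ^ k}"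

lemma prob_link_near_nodes:
  assumes S: "finite S" "t \<in> S"
    and Z: "(\<Sum>v\<in>S - {u}. 1 / pdist u v) \<le> H"
    and u: "2 ^ k < pdist u t" "pdist u t \<le> 2 ^ Suc k"
  shows "real (card (near_nodes S t k)) / (3 * 2 ^ k * H) \<le>
    measure_pmf.prob (link_pmf S u) (near_nodes S t k)"
proof -
  let ?N = "near_nodes S t k" and ?Z = "\<Sum>v\<in>S - {u}. 1 / pdist u v"
  have N: "?N \<subseteq> S - {u}" and fin: "finite ?N"
    using u S by (auto simp: near_nodes_def)
  have "t \<in> ?N"
    using S by (auto simp: near_nodes_def pdist_def)
  then have ne: "S - {u} \<noteq> {}" using N by blast
  have Zpos: "0 < ?Z"
    using S ne by (intro sum_pos) (auto simp: pdist_def)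
  have "real (card ?N) / (3 * 2 ^ k * H) = (\<Sum>v\<in>?N. 1 / (3 * 2 ^ k) / H)"
    by simp
  also have "\<dots> \<le> (\<Sum>v\<in>?N. pmf (link_pmf S u) v)"
  proof (intro sum_mono)
    fix v assume v: "v \<in> ?N"
    then have vu: "v \<in> S - {u}" using N by auto
    have "pdist u v \<le> pdist u t + pdist v t"
      by (simp add: pdist_def)
    also have "\<dots> \<le> 2 ^ Suc k + 2 ^ k"
      using u v by (intro add_mono) (auto simp: near_nodes_def)
    finally have "pdist u v \<le> 3 * 2 ^ k" by simp
    moreover have "0 < pdist u v"
      using vu by (auto simp: pdist_def)
    ultimately have "1 / (3 * 2 ^ k) / H \<le> 1 / pdist u v / ?Z"
      using Zpos Z by (intro frac_le) auto
    then show "1 / (3 * 2 ^ k) / H \<le> pmf (link_pmf S u) v"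
      using vu by (simp only: pmf_link_pmf[OF S(1) ne] if_True)
  qed
  also have "\<dots> = measure_pmf.prob (link_pmf S u) ?N"
    using fin by (simp add: measure_measure_pmf_finite)
  finally show ?thesis .
qed

lemma finite_powers_less: "finite {j. 2 ^ j < (x :: real)}"
proof -
  obtain m where m: "x < 2 ^ m"
    using real_arch_pow[of 2 x] by auto
  have "{j. 2 ^ j < x} \<subseteq> {..<m}"
  proof
    fix j assume "j \<in> {j. 2 ^ j < x}"
    then have "2 ^ j < x" by simp
    also note m
    finally have "(2::real) ^ j < 2 ^ m" .
    then show "j \<in> {..<m}" by simp
  qed
  then show ?thesis by (rule finite_subset) simp
qed

lemma dyadic_scale:
  fixes x :: real
  assumes "1 < x"
  obtains k where "2 ^ k < x" and "x \<le> 2 ^ Suc k" and "{j. 2 ^ j < x} = {..k}"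
proof -
  let ?J = "{j. 2 ^ j < x}"
  define k where "k = Max ?J"
  have "0 \<in> ?J" using assms by simp
  then have ne: "?J \<noteq> {}" by blast
  have k: "k \<in> ?J"
    unfolding k_def by (rule Max_in[OF finite_powers_less ne])
  have k_max: "j \<le> k" if "j \<in> ?J" for j
    unfolding k_def by (rule Max_ge[OF finite_powers_less that])
  have "2 ^ j < x" if "j \<le> k" for j
    using k power_increasing[OF that, of "2::real"] by (auto simp del: power_increasing_iff)
  then have "?J = {..k}" using k_max by auto
  moreover have "x \<le> 2 ^ Suc k"
    using k_max[of "Suc k"] by (intro leI) auto
  ultimately show ?thesis using k by (intro that) auto
qed

text \<open>The right-hand side is a potential that is constant on each scale and drops by the
  reciprocal of the escape probability between scales, so every hop lowers its mean by at least
  \<open>1\<close>. The leading \<open>1\<close> pays for the last hop, from distance \<open>1\<close>.\<close>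

lemma fixed_nodes_time_le:
  assumes g: "greedy_rule g" and S: "finite S" "t \<in> S" "u \<in> S"
    and Z: "\<And>w. w \<in> S \<Longrightarrow> (\<Sum>v\<in>S - {w}. 1 / pdist w v) \<le> H"
  shows "fixed_nodes_time g S u t \<le>
    1 + (\<Sum>j | 2 ^ j < pdist u t. 3 * 2 ^ j * H / real (card (near_nodes S t j)))"
  using S(3)
proof (induction "nat \<lfloor>pdist u t\<rfloor>" arbitrary: u rule: less_induct)
  case less
  define a where "a j = 3 * 2 ^ j * H / real (card (near_nodes S t j))" for j
  have "0 \<le> H"
    using Z[OF S(2)] by (rule order_trans[rotated]) (auto intro!: sum_nonneg simp: pdist_def)
  then have a_nonneg: "0 \<le> a j" for j
    by (simp add: a_def)
  have sum_mono': "(\<Sum>j\<in>I. a j) \<le> (\<Sum>j\<in>J. a j)" if "I \<subseteq> J" "finite J" for I J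
    using that a_nonneg by (intro sum_mono2) auto
  consider "u = t" | "u \<noteq> t" "pdist u t \<le> 1" | "1 < pdist u t" by linarith
  then have "fixed_nodes_time g S u t \<le> 1 + (\<Sum>j | 2 ^ j < pdist u t. a j)"
  proof cases
    case 1
    then show ?thesis
      using a_nonneg by (simp add: fixed_nodes_time_def delivery_time_self sum_nonneg)
  next
    case 2
    have "fixed_nodes_time g S (next_hop g S u t x) t = 0" if "x \<in> set_pmf (link_pmf S u)" for x
    proof -
      have "x \<in> S"
        using that set_link_pmf[OF S(1) less.prems] by auto
      then have "pdist (next_hop g S u t x) t < 1"
        using next_hop_closer(2)[OF g S(1,2) less.prems 2(1)] 2(2) by fastforce
      then have "next_hop g S u t x = t"
        by (simp add: pdist_def)
      then show ?thesis
        by (simp add: fixed_nodes_time_def delivery_time_self)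
    qed
    then have "measure_pmf.expectation (link_pmf S u)
        (\<lambda>x. fixed_nodes_time g S (next_hop g S u t x) t) = 0"
      using expectation_cong_pmf[of "link_pmf S u" _ "\<lambda>_. 0"] by simp
    then show ?thesis
      using fixed_nodes_time_step[OF g S(1,2) less.prems 2(1)] a_nonneg by (simp add: sum_nonneg)
  next
    case 3
    then have ut: "u \<noteq> t" by (auto simp: pdist_def)
    obtain k where k: "2 ^ k < pdist u t" "pdist u t \<le> 2 ^ Suc k" "{j. 2 ^ j < pdist u t} = {..k}"
      using dyadic_scale[OF 3] by blast
    let ?N = "near_nodes S t k" and ?\<Phi> = "1 + (\<Sum>j\<le>k. a j)"
    have finu: "finite (set_pmf (link_pmf S u))"
      using set_link_pmf[OF S(1) less.prems] S(1) by (rule finite_subset)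
    have hop: "fixed_nodes_time g S (next_hop g S u t x) t \<le> ?\<Phi> - a k * indicator ?N x"
      if "x \<in> set_pmf (link_pmf S u)" for x
    proof -
      let ?v = "next_hop g S u t x"
      have "x \<in> S"
        using that set_link_pmf[OF S(1) less.prems] by auto
      then have v: "?v \<in> S" "pdist ?v t < pdist u t"
        using next_hop_closer[OF g S(1,2) less.prems ut] by auto
      have IH: "fixed_nodes_time g S ?v t \<le> 1 + (\<Sum>j | 2 ^ j < pdist ?v t. a j)"
        using less.hyps[OF nat_floor_pdist_less[OF v(2)] v(1)] by (simp add: a_def)
      show ?thesis
      proof (cases "x \<in> ?N")
        case True
        then have le: "pdist ?v t \<le> 2 ^ k"
          using next_hop_le_link[OF g S(1), of u t x] by (simp add: near_nodes_def)
        have "{j. 2 ^ j < pdist ?v t} \<subseteq> {..<k}"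
        proof
          fix j assume "j \<in> {j. 2 ^ j < pdist ?v t}"
          then have "2 ^ j < pdist ?v t" by simp
          also note le
          finally have "(2::real) ^ j < 2 ^ k" .
          then show "j \<in> {..<k}" by simp
        qed
        then have "(\<Sum>j | 2 ^ j < pdist ?v t. a j) \<le> (\<Sum>j<k. a j)"
          by (intro sum_mono') auto
        also have "\<dots> = (\<Sum>j\<le>k. a j) - a k"
          by (simp add: lessThan_Suc_atMost[symmetric])
        finally show ?thesis using IH True by simp
      next
        case False
        have "{j. 2 ^ j < pdist ?v t} \<subseteq> {..k}"
          using v(2) k(3) by auto
        then have "(\<Sum>j | 2 ^ j < pdist ?v t. a j) \<le> (\<Sum>j\<le>k. a j)"
          by (intro sum_mono') auto
        then show ?thesis using IH False by simp
      qed
    qed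
    have "1 \<le> a k * measure_pmf.prob (link_pmf S u) ?N"
    proof -
      have "t \<in> ?N"
        using S by (simp add: near_nodes_def pdist_def)
      then have c: "0 < card ?N"
        using S(1) by (auto simp: card_gt_0_iff near_nodes_def)
      have "0 < 1 / pdist u t" using 3 by simp
      also have "1 / pdist u t \<le> (\<Sum>v\<in>S - {u}. 1 / pdist u v)"
        using S ut by (intro member_le_sum) (auto simp: pdist_def)
      also have "\<dots> \<le> H" by (rule Z[OF less.prems])
      finally have "1 = a k * (real (card ?N) / (3 * 2 ^ k * H))"
        using c by (simp add: a_def)
      also have "\<dots> \<le> a k * measure_pmf.prob (link_pmf S u) ?N"
        using a_nonneg prob_link_near_nodes[OF S(1,2) Z[OF less.prems] k(1,2)]
        by (rule mult_left_mono[rotated])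
      finally show ?thesis .
    qed
    moreover have "measure_pmf.expectation (link_pmf S u)
        (\<lambda>x. fixed_nodes_time g S (next_hop g S u t x) t) \<le>
        measure_pmf.expectation (link_pmf S u) (\<lambda>x. ?\<Phi> - a k * indicator ?N x)"
      using finu hop by (rule expectation_mono_pmf_finite)
    moreover have "measure_pmf.expectation (link_pmf S u) (\<lambda>x. ?\<Phi> - a k * indicator ?N x) =
        ?\<Phi> - a k * measure_pmf.prob (link_pmf S u) ?N"
      using finu by (subst Bochner_Integration.integral_diff) (auto intro: integrable_measure_pmf_finite)
    ultimately show ?thesis
      using fixed_nodes_time_step[OF g S(1,2) less.prems ut] k(3) by simp
  qed
  then show ?case by (simp add: a_def)
qed

section \<open>Averaging over the hosts\<close>

lemma sum_inverse_pdist_le: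
  assumes S: "S \<subseteq> {1..n}" and w: "w \<in> {1..n}"
  shows "(\<Sum>v\<in>S - {w}. 1 / pdist w v) \<le> 2 * harm n"
proof -
  have "(\<Sum>v\<in>S - {w}. 1 / pdist w v) \<le> (\<Sum>v\<in>{1..<w} \<union> {w<..n}. 1 / pdist w v)"
    using S w by (intro sum_mono2) (auto simp: pdist_def)
  also have "\<dots> = (\<Sum>v\<in>{1..<w}. 1 / pdist w v) + (\<Sum>v\<in>{w<..n}. 1 / pdist w v)"
    by (intro sum.union_disjoint) auto
  also have "(\<Sum>v\<in>{1..<w}. 1 / pdist w v) = (\<Sum>k\<in>{1..<w}. inverse (real k))"
    by (rule sum.reindex_bij_witness[of _ "\<lambda>k. w - k" "\<lambda>v. w - v"])
      (auto simp: pdist_def inverse_eq_divide of_nat_diff)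
  also have "\<dots> \<le> harm n"
    unfolding harm_def using w by (intro sum_mono2) auto
  also have "(\<Sum>v\<in>{w<..n}. 1 / pdist w v) = (\<Sum>k\<in>{1..n - w}. inverse (real k))"
    by (rule sum.reindex_bij_witness[of _ "\<lambda>k. w + k" "\<lambda>v. v - w"])
      (auto simp: pdist_def inverse_eq_divide of_nat_diff)
  also have "\<dots> \<le> harm n"
    unfolding harm_def by (intro sum_mono2) auto
  finally show ?thesis by simp
qed

definition segment_towards :: "nat \<Rightarrow> nat \<Rightarrow> nat \<Rightarrow> nat set" where
  "segment_towards s t m = (if t < s then {t<..t + m} else {t - m..<t})"

lemma segment_towards:
  assumes "s \<in> {1..n}" "t \<in> {1..n}" "real m < pdist s t"
  shows "segment_towards s t m \<subseteq> {1..n}" and "segment_towards s t m \<inter> {s, t} = {}"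
    and "card (segment_towards s t m) = m"
    and "\<And>v. v \<in> segment_towards s t m \<Longrightarrow> pdist v t \<le> real m"
  using assms by (auto simp: segment_towards_def pdist_def split: if_splits)

lemma card_near_nodes_ge:
  assumes "s \<in> {1..n}" "t \<in> {1..n}" "2 ^ j < pdist s t" "finite S" "t \<in> S"
  shows "1 + card (S \<inter> segment_towards s t (2 ^ j)) \<le> card (near_nodes S t j)"
proof -
  let ?A = "segment_towards s t (2 ^ j)"
  have j: "real (2 ^ j) < pdist s t" using assms(3) by simp
  have "t \<notin> ?A"
    using segment_towards(2)[OF assms(1,2) j] by blast
  then have "1 + card (S \<inter> ?A) = card (insert t (S \<inter> ?A))"
    using assms(4) by simp
  also have "\<dots> \<le> card (near_nodes S t j)"
    using assms(4,5) segment_towards(4)[OF assms(1,2) j]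
    by (intro card_mono) (auto simp: near_nodes_def pdist_def)
  finally show ?thesis .
qed

lemma finite_set_network_pmf: "finite (set_pmf (network_pmf n p))"
proof -
  have "finite (set_pmf (Pi_pmf S 0 (link_pmf S)))" if "S \<in> set_pmf (nodes_pmf n p)" for S
    using set_nodes_pmf_subset[OF that] by (intro finite_set_links_pmf) (rule finite_subset, auto)
  then show ?thesis
    by (auto simp: network_pmf_def finite_set_nodes_pmf)
qed

lemma map_fst_network_pmf: "map_pmf fst (network_pmf n p) = nodes_pmf n p"
  by (simp add: network_pmf_def map_bind_pmf map_pmf_comp bind_return_pmf')

lemma expected_delivery_time_eq:
  assumes "0 < p" "p \<le> 1" "s \<in> {1..n}" "t \<in> {1..n}"
  shows "expected_delivery_time g n p s t =
    measure_pmf.expectation (nodes_pmf n p) (\<lambda>S. of_bool ({s, t} \<subseteq> S) * fixed_nodes_time g S s t)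
      / measure_pmf.prob (nodes_pmf n p) {S. {s, t} \<subseteq> S}"
    and "0 < measure_pmf.prob (nodes_pmf n p) {S. {s, t} \<subseteq> S}"
proof -
  let ?A = "{(S, L :: nat \<Rightarrow> nat). s \<in> S \<and> t \<in> S}"
  have prob: "measure_pmf.prob (network_pmf n p) ?A = measure_pmf.prob (nodes_pmf n p) {S. {s, t} \<subseteq> S}"
  proof -
    have "?A = fst -` {S. {s, t} \<subseteq> S}" by auto
    then show ?thesis
      by (simp only: map_fst_network_pmf[symmetric] measure_map_pmf)
  qed
  note ne = network_pmf_cond_nonempty[OF assms]
  show "0 < measure_pmf.prob (nodes_pmf n p) {S. {s, t} \<subseteq> S}"
    unfolding prob[symmetric] zero_less_measure_iff by (rule measure_measure_pmf_not_zero[OF ne])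
  have fin: "finite (set_pmf (Pi_pmf S 0 (link_pmf S)))" if "S \<in> set_pmf (nodes_pmf n p)" for S
    using set_nodes_pmf_subset[OF that] by (intro finite_set_links_pmf) (rule finite_subset, auto)
  have "expected_delivery_time g n p s t =
      measure_pmf.expectation (network_pmf n p)
        (\<lambda>x. indicator ?A x * (case x of (S, L) \<Rightarrow> real (delivery_time g S L s t)))
      / measure_pmf.prob (network_pmf n p) ?A"
    unfolding expected_delivery_time_def
    by (rule expectation_cond_pmf_finite[OF finite_set_network_pmf ne])
  also have "measure_pmf.expectation (network_pmf n p)
        (\<lambda>x. indicator ?A x * (case x of (S, L) \<Rightarrow> real (delivery_time g S L s t))) =
      measure_pmf.expectation (nodes_pmf n p) (\<lambda>S. measure_pmf.expectation (Pi_pmf S 0 (link_pmf S))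
        (\<lambda>L. of_bool ({s, t} \<subseteq> S) * real (delivery_time g S L s t)))"
    unfolding network_pmf_def using fin
    by (subst expectation_bind_pmf_finite) (auto simp: finite_set_nodes_pmf indicator_def)
  finally show "expected_delivery_time g n p s t =
    measure_pmf.expectation (nodes_pmf n p) (\<lambda>S. of_bool ({s, t} \<subseteq> S) * fixed_nodes_time g S s t)
      / measure_pmf.prob (nodes_pmf n p) {S. {s, t} \<subseteq> S}"
    by (simp only: prob fixed_nodes_time_def integral_mult_right_zero)
qed

lemma expected_delivery_time_le:
  assumes p: "0 < p" "p \<le> 1" and g: "greedy_rule g" and st: "s \<in> {1..n}" "t \<in> {1..n}"
  shows "expected_delivery_time g n p s t \<le> 1 + real (card {j. 2 ^ j < pdist s t}) * (6 * harm n / p)"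
proof -
  let ?M = "nodes_pmf n p" and ?J = "{j. 2 ^ j < pdist s t}"
  let ?A = "\<lambda>j. segment_towards s t (2 ^ j)" and ?h = "harm n :: real"
  define P where "P = measure_pmf.prob ?M {S. {s, t} \<subseteq> S}"
  note fin = finite_set_nodes_pmf[of n p]
  have h: "0 \<le> ?h" by (rule harm_nonneg)
  have P: "0 < P"
    unfolding P_def using expected_delivery_time_eq(2)[OF p st] .
  have "measure_pmf.expectation ?M (\<lambda>S. of_bool ({s, t} \<subseteq> S) * fixed_nodes_time g S s t) \<le>
      measure_pmf.expectation ?M (\<lambda>S. indicator {S. {s, t} \<subseteq> S} S +
        (\<Sum>j\<in>?J. 6 * 2 ^ j * ?h * (of_bool ({s, t} \<subseteq> S) * (1 / (1 + real (card (S \<inter> ?A j)))))))"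
  proof (rule expectation_mono_pmf_finite[OF fin])
    fix S assume "S \<in> set_pmf ?M"
    then have S: "S \<subseteq> {1..n}" by (rule set_nodes_pmf_subset)
    then have finS: "finite S" by (rule finite_subset) simp
    show "of_bool ({s, t} \<subseteq> S) * fixed_nodes_time g S s t \<le> indicator {S. {s, t} \<subseteq> S} S +
        (\<Sum>j\<in>?J. 6 * 2 ^ j * ?h * (of_bool ({s, t} \<subseteq> S) * (1 / (1 + real (card (S \<inter> ?A j))))))"
    proof (cases "{s, t} \<subseteq> S")
      case True
      then have "fixed_nodes_time g S s t \<le>
          1 + (\<Sum>j\<in>?J. 3 * 2 ^ j * (2 * ?h) / real (card (near_nodes S t j)))"
        using S by (intro fixed_nodes_time_le g finS sum_inverse_pdist_le) auto
      also have "\<dots> \<le> 1 + (\<Sum>j\<in>?J. 6 * 2 ^ j * ?h * (1 / (1 + real (card (S \<inter> ?A j)))))"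
      proof (intro add_left_mono sum_mono)
        fix j assume "j \<in> ?J"
        then have "1 + card (S \<inter> ?A j) \<le> card (near_nodes S t j)"
          using True by (intro card_near_nodes_ge[OF st] finS) auto
        then have "1 + real (card (S \<inter> ?A j)) \<le> real (card (near_nodes S t j))"
          by linarith
        then have "6 * 2 ^ j * ?h / real (card (near_nodes S t j)) \<le>
            6 * 2 ^ j * ?h / (1 + real (card (S \<inter> ?A j)))"
          using h by (intro divide_left_mono) auto
        then show "3 * 2 ^ j * (2 * ?h) / real (card (near_nodes S t j)) \<le>
            6 * 2 ^ j * ?h * (1 / (1 + real (card (S \<inter> ?A j))))"
          by simp
      qed
      finally show ?thesis using True by simp
    next
      case False
      then have "of_bool ({s, t} \<subseteq> S) = (0 :: real)" by simp
      then show ?thesis by (simp only: mult_zero_left) (simp add: sum_nonneg)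
    qed
  qed
  also have "\<dots> = P + (\<Sum>j\<in>?J. 6 * 2 ^ j * ?h * measure_pmf.expectation ?M
      (\<lambda>S. of_bool ({s, t} \<subseteq> S) * (1 / (1 + real (card (S \<inter> ?A j))))))"
    by (simp only: P_def Bochner_Integration.integral_add Bochner_Integration.integral_sum
      integrable_measure_pmf_finite[OF fin] integral_mult_right_zero) (simp del: insert_subset)
  also have "\<dots> \<le> P + (\<Sum>j\<in>?J. P * (6 * ?h / p))"
  proof (intro add_left_mono sum_mono)
    fix j assume "j \<in> ?J"
    then have j: "real (2 ^ j) < pdist s t" by simp
    have "measure_pmf.expectation ?M
        (\<lambda>S. of_bool ({s, t} \<subseteq> S) * (1 / (1 + real (card (S \<inter> ?A j)))))
        \<le> P / ((real (card (?A j)) + 1) * p)"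
      unfolding P_def using st segment_towards(1,2)[OF st j]
      by (intro expectation_inverse_card_nodes p) auto
    also have "\<dots> \<le> P / (2 ^ j * p)"
      using P p segment_towards(3)[OF st j]
      by (intro divide_left_mono mult_right_mono mult_pos_pos) (auto intro: add_pos_pos)
    finally have "6 * 2 ^ j * ?h * measure_pmf.expectation ?M
        (\<lambda>S. of_bool ({s, t} \<subseteq> S) * (1 / (1 + real (card (S \<inter> ?A j)))))
        \<le> 6 * 2 ^ j * ?h * (P / (2 ^ j * p))"
      using h by (intro mult_left_mono) auto
    then show "6 * 2 ^ j * ?h * measure_pmf.expectation ?M
        (\<lambda>S. of_bool ({s, t} \<subseteq> S) * (1 / (1 + real (card (S \<inter> ?A j)))))
        \<le> P * (6 * ?h / p)"
      using p by (simp add: field_simps)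
  qed
  also have "\<dots> = P * (1 + real (card ?J) * (6 * ?h / p))"
    by (simp add: algebra_simps)
  finally show ?thesis
    unfolding expected_delivery_time_eq(1)[OF p st] P_def[symmetric] pos_divide_le_eq[OF P]
    by (simp only: mult.commute)
qed

lemma card_powers_less:
  assumes "x \<le> real n" "1 \<le> n"
  shows "real (card {j. 2 ^ j < x}) \<le> 1 + log 2 (real n)"
proof (cases "1 < x")
  case True
  obtain k where k: "2 ^ k < x" "{j. 2 ^ j < x} = {..k}"
    using dyadic_scale[OF True] by blast
  have "2 powr real k \<le> real n"
    using k(1) assms(1) by (simp only: powr_realpow zero_less_numeral)
  then have "real k \<le> log 2 (real n)"
    using assms by (simp add: le_log_iff)
  then show ?thesis by (simp add: k(2))
next
  case False
  have "(1::real) \<le> 2 ^ j" for j by simp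
  then have "{j. 2 ^ j < x} = {}"
    using False by (auto simp: not_less intro: order_trans)
  then show ?thesis using assms by simp
qed

theorem theorem9:
  fixes p :: real and g :: "nat \<Rightarrow> nat \<Rightarrow> nat set \<Rightarrow> nat"
  assumes "0 < p" and "p \<le> 1" and "greedy_rule g"
  shows "(\<lambda>n. worst_case_expected_delivery_time g p n) \<in> O(\<lambda>n. (ln (real n))\<^sup>2)"
proof (rule bigoI)
  let ?c = "1 + (1 + 1 / ln 2) * (12 / p)"
  show "eventually (\<lambda>n. norm (worst_case_expected_delivery_time g p n) \<le> ?c * norm ((ln (real n))\<^sup>2)) sequentially"
    using eventually_ge_at_top[of 3]
  proof eventually_elim
    fix n :: nat assume n: "3 \<le> n"
    define l where "l = ln (real n)"
    let ?E = "{expected_delivery_time g n p s t | s t. s \<in> {1..n} \<and> t \<in> {1..n}}"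
    have l: "1 \<le> l"
      unfolding l_def using n exp_le by (subst ln_ge_iff) auto
    have E: "0 \<le> e \<and> e \<le> ?c * l\<^sup>2" if eE: "e \<in> ?E" for e
    proof -
      obtain s t where e: "e = expected_delivery_time g n p s t" and st: "s \<in> {1..n}" "t \<in> {1..n}"
        using eE by blast
      have "0 \<le> e"
        unfolding e expected_delivery_time_def by (intro integral_nonneg_AE) auto
      have "harm n \<le> 1 + l"
        using euler_mascheroni_sequence_decreasing[of 1 n] n by (simp add: l_def harm_expand)
      then have h: "harm n \<le> 2 * l" using l by simp
      have "pdist s t \<le> real n"
        using st by (auto simp: pdist_def)
      then have "real (card {j. 2 ^ j < pdist s t}) \<le> 1 + l / ln 2"
        using card_powers_less[of "pdist s t" n] n by (simp add: l_def log_def)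
      also have "\<dots> \<le> (1 + 1 / ln 2) * l"
        using l by (simp add: algebra_simps)
      finally have c: "real (card {j. 2 ^ j < pdist s t}) \<le> (1 + 1 / ln 2) * l" .
      have "e \<le> 1 + real (card {j. 2 ^ j < pdist s t}) * (6 * harm n / p)"
        unfolding e by (rule expected_delivery_time_le[OF assms st])
      also have "\<dots> \<le> l\<^sup>2 + ((1 + 1 / ln 2) * l) * (6 * (2 * l) / p)"
        using l h c assms by (intro add_mono mult_mono divide_right_mono mult_left_mono)
          (auto simp: harm_nonneg)
      also have "\<dots> = ?c * l\<^sup>2"
        by (simp add: power2_eq_square add_divide_distrib algebra_simps)
      finally show ?thesis using \<open>0 \<le> e\<close> by simp
    qed
    have "?E = (\<lambda>(s, t). expected_delivery_time g n p s t) ` ({1..n} \<times> {1..n})"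
      by force
    then have "finite ?E" "?E \<noteq> {}"
      using n by auto
    then have "worst_case_expected_delivery_time g p n \<in> ?E"
      unfolding worst_case_expected_delivery_time_def by (rule Max_in)
    from E[OF this] show "norm (worst_case_expected_delivery_time g p n) \<le> ?c * norm ((ln (real n))\<^sup>2)"
      by (simp add: l_def)
  qed
qed

end
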